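(* There is an absolute constant $C>0$ such that the following holds. Let $N$ and $d$ be positive integers, let $\alpha\in\mathbb{T}^d$ and $\rho>0$, and suppose that the Bohr set $B=B(\alpha,\rho)\subset[N]$ is regular. Then for every Sidon set $S\subset[N]$ with $|S|\geq\frac{1}{100}N^{1/2}$, $$\left|\mathbb{E}_{x\in S}1_B(x)-\mathbb{E}_{x\in[N]}1_B(x)\right|\leq C d\rho^{-1}\left(\left|\frac{|S|}{N^{1/2}}-1\right|+N^{-1/6}\right)^{\frac{1}{14d}}.$$
   Context: $[N]=\{1,2,\dots,N\}$, $\mathbb{T}=\mathbb{R}/\mathbb{Z}$, and $\|\alpha\|=\min_{n\in\mathbb{Z}}|\alpha-n|$ for $\alpha\in\mathbb{T}$. A set $S\subset\mathbb{Z}$ is Sidon if every non-zero integer $x$ has at most one representation $x=s_1-s_2$ with $s_1,s_2\in S$. For a finite non-empty set $A$, $\mathbb{E}_{x\in A}f(x)=\frac{1}{|A|}\sum_{x\in A}f(x)$; $1_B$ is the indicator function of $B$. Given $\alpha\in\mathbb{T}^d$ and $\rho>0$, the Bohr set is $B(\alpha,\rho)=\{x\in[N]:\max_i\|\alpha_ix\|\leq\rho\}$. It is called regular if for every real $\kappa$ with $|\kappa|\leq\frac{1}{100d}$, $$\left|\frac{|B(\alpha,(1+\kappa)\rho)|}{|B(\alpha,\rho)|}-1\right|\leq 100d|\kappa|.$$ *)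

theory Defs
  imports "HOL-Analysis.Analysis"
begin

text \<open>
  \<open>initial_segment N\<close> is the set \<open>[N]\<close>.
  A point of the torus \<open>(\<real>/\<int>)^d\<close> is given by real representatives
  \<open>\<alpha> i\<close>, \<open>i \<in> {1..d}\<close>; values of \<open>\<alpha>\<close> at other indices are never used.
  The choice of representatives is immaterial by \<open>bohr_set_cong\<close>.
\<close>

definition initial_segment :: "nat \<Rightarrow> int set" where
  "initial_segment N = {1..int N}"

definition dist_int :: "real \<Rightarrow> real" where
  "dist_int x = (INF n::int. \<bar>x - of_int n\<bar>)"

text \<open>The infimum is a minimum.\<close>

lemma dist_int_eq_round: "dist_int x = \<bar>x - of_int (round x)\<bar>"
  unfolding dist_int_def
proof (rule cInf_eq_minimum)
  show "\<bar>x - of_int (round x)\<bar> \<in> range (\<lambda>n::int. \<bar>x - of_int n\<bar>)"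
    by blast
  show "\<bar>x - of_int (round x)\<bar> \<le> y" if "y \<in> range (\<lambda>n::int. \<bar>x - of_int n\<bar>)" for y
    using that round_diff_minimal[of x] by auto
qed

lemma dist_int_add_of_int: "dist_int (x + of_int k) = dist_int x"
proof -
  have "range (\<lambda>n::int. \<bar>x + of_int k - of_int n\<bar>) = range (\<lambda>n::int. \<bar>x - of_int n\<bar>)"
  proof (intro equalityI subsetI)
    fix y assume "y \<in> range (\<lambda>n::int. \<bar>x + of_int k - of_int n\<bar>)"
    then obtain n :: int where "y = \<bar>x + of_int k - of_int n\<bar>" by blast
    then have "y = \<bar>x - of_int (n - k)\<bar>" by (simp add: algebra_simps)
    then show "y \<in> range (\<lambda>n::int. \<bar>x - of_int n\<bar>)" by blast
  next
    fix y assume "y \<in> range (\<lambda>n::int. \<bar>x - of_int n\<bar>)"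
    then obtain n :: int where "y = \<bar>x - of_int n\<bar>" by blast
    then have "y = \<bar>x + of_int k - of_int (n + k)\<bar>" by (simp add: algebra_simps)
    then show "y \<in> range (\<lambda>n::int. \<bar>x + of_int k - of_int n\<bar>)" by blast
  qed
  then show ?thesis by (simp add: dist_int_def)
qed

definition sidon :: "int set \<Rightarrow> bool" where
  "sidon S \<longleftrightarrow>
    (\<forall>x. x \<noteq> 0 \<longrightarrow> (\<exists>\<^sub>\<le>\<^sub>1 p. p \<in> S \<times> S \<and> x = fst p - snd p))"

definition average :: "'a set \<Rightarrow> ('a \<Rightarrow> real) \<Rightarrow> real" where
  "average A f = (\<Sum>x\<in>A. f x) / real (card A)"

definition bohr_set :: "nat \<Rightarrow> nat \<Rightarrow> (nat \<Rightarrow> real) \<Rightarrow> real \<Rightarrow> int set" where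
  "bohr_set N d \<alpha> \<rho> =
    {x \<in> initial_segment N. (MAX i\<in>{1..d}. dist_int (\<alpha> i * of_int x)) \<le> \<rho>}"

lemma bohr_set_cong:
  assumes "\<And>i. i \<in> {1..d} \<Longrightarrow> \<alpha> i - \<beta> i \<in> \<int>"
  shows "bohr_set N d \<alpha> \<rho> = bohr_set N d \<beta> \<rho>"
proof -
  have "dist_int (\<alpha> i * of_int x) = dist_int (\<beta> i * of_int x)" if i: "i \<in> {1..d}" for i x
  proof -
    obtain k :: int where "\<alpha> i - \<beta> i = of_int k"
      using assms[OF i] by (auto elim: Ints_cases)
    then have "\<alpha> i * of_int x = \<beta> i * of_int x + of_int (k * x)"
      by (simp add: diff_eq_eq distrib_left mult.commute)
    then show ?thesis by (simp only: dist_int_add_of_int)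
  qed
  then have "(\<lambda>i. dist_int (\<alpha> i * of_int x)) ` {1..d} =
      (\<lambda>i. dist_int (\<beta> i * of_int x)) ` {1..d}" for x
    by (intro image_cong) auto
  then show ?thesis by (simp add: bohr_set_def)
qed

text \<open>
  Taking \<open>\<kappa> = 0\<close> shows that a regular Bohr set is non-empty, because the
  quotient below is \<open>0\<close> when the denominator is \<open>0\<close>.
\<close>

definition regular_bohr :: "nat \<Rightarrow> nat \<Rightarrow> (nat \<Rightarrow> real) \<Rightarrow> real \<Rightarrow> bool" where
  "regular_bohr N d \<alpha> \<rho> \<longleftrightarrow>
    (\<forall>\<kappa>::real. \<bar>\<kappa>\<bar> \<le> 1 / (100 * real d) \<longrightarrow>
      \<bar>real (card (bohr_set N d \<alpha> ((1 + \<kappa>) * \<rho>))) / real (card (bohr_set N d \<alpha> \<rho>)) - 1\<bar>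
        \<le> 100 * real d * \<bar>\<kappa>\<bar>)"

end

theory Submission
  imports Defs
begin

text \<open>
  Let \<open>W\<close> be the set of integers of absolute value at most \<open>H\<close> in a narrow Bohr set with the
  same frequencies. Since \<open>S\<close> is Sidon, the convolution of \<open>1\<^sub>S\<close> with the uniform probability
  measure on \<open>W\<close> has squared \<open>L\<^sup>2\<close> norm at most \<open>1 + |S| / |W|\<close>, while its total mass is
  \<open>|S| \<approx> \<surd>N\<close> on an interval of length \<open>N + 2H\<close>. This is nearly equality in the Cauchy--Schwarz
  inequality, so the convolution is close in \<open>L\<^sup>2\<close> to a constant. Translation by an
  element of \<open>W\<close> moves a Bohr set into a slightly wider one, and regularity absorbs the change
  of width. The argument is applied to \<open>S \<inter> B\<close> and to \<open>S - B\<close>.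
\<close>

section \<open>Distance to the nearest integer, Bohr sets and averages\<close>

lemma dist_int_le: "dist_int x \<le> \<bar>x - of_int n\<bar>"
  by (simp add: dist_int_eq_round round_diff_minimal)

lemma dist_int_le_half: "dist_int x \<le> 1 / 2"
  using of_int_round_abs_le[of x] by (simp add: dist_int_eq_round abs_minus_commute)

lemma dist_int_add_le: "dist_int (x + y) \<le> dist_int x + dist_int y"
  using dist_int_le[of "x + y" "round x + round y"]
  by (simp add: dist_int_eq_round)

lemma dist_int_uminus_le: "dist_int (- x) \<le> dist_int x"
  using dist_int_le[of "- x" "- round x"] by (simp add: dist_int_eq_round)

lemma mem_bohr_set_iff:
  assumes "d > 0"
  shows "x \<in> bohr_set N d \<alpha> \<rho> \<longleftrightarrow>
    x \<in> {1..int N} \<and> (\<forall>i\<in>{1..d}. dist_int (\<alpha> i * of_int x) \<le> \<rho>)"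
  using assms by (auto simp: bohr_set_def initial_segment_def)

lemma average_indicat_real:
  assumes "finite A"
  shows "average A (indicat_real B) = real (card (A \<inter> B)) / real (card A)"
  using assms by (simp add: average_def indicator_def if_distrib sum.If_cases Int_def cong: if_cong)

section \<open>Sidon sets: overlaps of translates and the second moment\<close>

text \<open>A point \<open>t\<close> common to \<open>S + v\<close> and \<open>S + w\<close>
  represents the non-zero integer \<open>w - v\<close> as \<open>(t - v) - (t - w)\<close>, and the
  Sidon property leaves room for only one such \<open>t\<close>.\<close>

lemma sidon_translates:
  assumes "sidon S" "v \<noteq> w" "finite I"
  shows "card {t \<in> I. t - v \<in> S \<and> t - w \<in> S} \<le> 1"
proof -
  have "t = u" if "t - v \<in> S" "t - w \<in> S" "u - v \<in> S" "u - w \<in> S" for t u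
  proof -
    have "w - v \<noteq> 0" using assms(2) by simp
    with assms(1) have "\<exists>\<^sub>\<le>\<^sub>1 p. p \<in> S \<times> S \<and> w - v = fst p - snd p"
      unfolding sidon_def by blast
    then have "(t - v, t - w) = (u - v, u - w)"
      by (rule Uniq_D) (use that in simp_all)
    then show ?thesis by simp
  qed
  then show ?thesis
    using assms(3) by (simp add: card_le_Suc0_iff_eq)
qed

lemma card_translate_Int:
  fixes S :: "int set"
  assumes "finite S" "finite I"
  shows "(\<Sum>t\<in>I. indicat_real S (t - w)) = real (card {s \<in> S. s + w \<in> I})"
proof -
  have "(\<Sum>t\<in>I. indicat_real S (t - w)) = real (card {t \<in> I. t - w \<in> S})"
    using assms(2) by (simp add: indicator_def if_distrib sum.If_cases Int_def cong: if_cong)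
  also have "card {t \<in> I. t - w \<in> S} = card {s \<in> S. s + w \<in> I}"
    by (rule bij_betw_same_card[of "\<lambda>t. t - w"], rule bij_betw_byWitness[where f' = "\<lambda>s. s + w"]) auto
  finally show ?thesis .
qed

text \<open>Expanding the square leaves, for each pair \<open>(v, w)\<close>, the number of points
  of \<open>I\<close> in both \<open>S + v\<close> and \<open>S + w\<close>. This is at most
  \<open>|S|\<close> on the diagonal and at most 1 off it.\<close>

lemma sidon_convolution_L2:
  assumes "sidon S" "finite S" "finite W" "finite I"
  shows "(\<Sum>t\<in>I. (\<Sum>w\<in>W. indicat_real S (t - w))\<^sup>2)
    \<le> real (card S) * real (card W) + (real (card W))\<^sup>2"
proof -
  let ?f = "\<lambda>v w. \<Sum>t\<in>I. indicat_real S (t - v) * indicat_real S (t - w)"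
  have le: "?f v w \<le> (if v = w then real (card S) else 0) + 1" for v w
  proof (cases "v = w")
    case True
    have "?f v w = (\<Sum>t\<in>I. indicat_real S (t - v))"
      using True by (intro sum.cong) (auto simp: indicator_def)
    also have "\<dots> \<le> real (card S)"
      using assms by (simp add: card_translate_Int card_mono)
    finally show ?thesis using True by simp
  next
    case False
    have "?f v w = real (card {t \<in> I. t - v \<in> S \<and> t - w \<in> S})"
      using assms(4)
      by (simp add: indicator_def Int_def flip: of_bool_conj)
    then show ?thesis using sidon_translates[OF assms(1) False assms(4)] False by simp
  qed
  have "(\<Sum>t\<in>I. (\<Sum>w\<in>W. indicat_real S (t - w))\<^sup>2)
      = (\<Sum>t\<in>I. \<Sum>v\<in>W. \<Sum>w\<in>W. indicat_real S (t - v) * indicat_real S (t - w))"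
    by (simp add: power2_eq_square sum_product)
  also have "\<dots> = (\<Sum>v\<in>W. \<Sum>w\<in>W. ?f v w)"
    by (subst sum.swap) (intro sum.cong refl sum.swap)
  also have "\<dots> \<le> (\<Sum>v\<in>W. \<Sum>w\<in>W. (if v = w then real (card S) else 0) + 1)"
    by (intro sum_mono le)
  also have "\<dots> = real (card S) * real (card W) + (real (card W))\<^sup>2"
    using assms(3) by (simp add: sum.distrib power2_eq_square distrib_left mult.commute)
  finally show ?thesis .
qed

text \<open>The second moment bounds the variance of the convolution on \<open>I\<close>, and
  Cauchy-Schwarz then bounds its mass on \<open>T\<close>. Each element of \<open>R\<close> puts all
  its \<open>|W|\<close> translates into \<open>T\<close>, so it uses up its full share of that
  mass. The expression under the root bounds the deficit in Cauchy-Schwarz over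
  \<open>I\<close>.\<close>

lemma sidon_translates_discrepancy:
  assumes "sidon S" "finite S" "finite W" "W \<noteq> {}" "finite I" "I \<noteq> {}"
    and SW: "\<And>s w. s \<in> S \<Longrightarrow> w \<in> W \<Longrightarrow> s + w \<in> I"
    and "R \<subseteq> S" "T \<subseteq> I"
    and RW: "\<And>s w. s \<in> R \<Longrightarrow> w \<in> W \<Longrightarrow> s + w \<in> T"
  shows "real (card R) \<le> real (card T) * real (card S) / real (card I)
    + sqrt (real (card I) * (1 + real (card S) / real (card W)) - (real (card S))\<^sup>2)"
proof -
  define A where "A t = (\<Sum>w\<in>W. indicat_real S (t - w))" for t
  define s k m where "s = real (card S)" and "k = real (card W)" and "m = real (card I)"
  define c where "c = s * k / m"
  have k: "k > 0" and m: "m > 0" and s: "s \<ge> 0"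
    using assms by (simp_all add: s_def k_def m_def card_gt_0_iff)
  have fT: "finite T" using assms finite_subset by blast
  have sumA: "(\<Sum>t\<in>I. A t) = s * k"
  proof -
    have "(\<Sum>t\<in>I. A t) = (\<Sum>w\<in>W. \<Sum>t\<in>I. indicat_real S (t - w))"
      unfolding A_def by (rule sum.swap)
    also have "\<dots> = (\<Sum>w\<in>W. real (card S))"
      using assms by (intro sum.cong refl) (auto simp: card_translate_Int intro!: arg_cong[of _ _ card])
    finally show ?thesis by (simp add: s_def k_def)
  qed
  have "(\<Sum>t\<in>I. (A t - c)\<^sup>2) = (\<Sum>t\<in>I. (A t)\<^sup>2) - 2 * c * (\<Sum>t\<in>I. A t) + m * c\<^sup>2"
    by (simp add: power2_diff sum.distrib sum_subtractf m_def sum_distrib_left sum_distrib_right mult_ac)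
  also have "\<dots> \<le> s * k + k\<^sup>2 - 2 * c * (s * k) + m * c\<^sup>2"
    using sidon_convolution_L2[OF assms(1,2,3,5)] unfolding sumA by (simp add: A_def s_def k_def)
  also have "\<dots> = k\<^sup>2 * (m * (1 + s / k) - s\<^sup>2) / m"
    using k m by (simp add: c_def field_simps power2_eq_square)
  finally have var: "(\<Sum>t\<in>I. (A t - c)\<^sup>2) \<le> k\<^sup>2 * (m * (1 + s / k) - s\<^sup>2) / m" .
  have "(\<Sum>t\<in>T. A t - c)\<^sup>2 \<le> (\<Sum>t\<in>T. (A t - c)\<^sup>2) * real (card T)"
    using Cauchy_Schwarz_ineq_sum[of "\<lambda>t. A t - c" "\<lambda>_. 1" T] by simp
  \<comment> \<open>Enlarging \<open>T\<close> to \<open>I\<close> in both factors makes the bound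
    independent of \<open>T\<close>.\<close>
  also have "\<dots> \<le> (\<Sum>t\<in>I. (A t - c)\<^sup>2) * m"
    unfolding m_def using assms by (intro mult_mono sum_mono2) (auto intro!: card_mono sum_nonneg)
  also have "\<dots> \<le> k\<^sup>2 * (m * (1 + s / k) - s\<^sup>2)"
    using var m by (simp add: field_simps)
  finally have "(\<Sum>t\<in>T. A t - c) \<le> sqrt (k\<^sup>2 * (m * (1 + s / k) - s\<^sup>2))"
    by (rule real_le_rsqrt)
  then have dev: "(\<Sum>t\<in>T. A t) \<le> real (card T) * c + k * sqrt (m * (1 + s / k) - s\<^sup>2)"
    using k by (simp add: sum_subtractf real_sqrt_mult)
  have "real (card R) * k = (\<Sum>w\<in>W. real (card R))"
    by (simp add: k_def)
  also have "\<dots> \<le> (\<Sum>w\<in>W. \<Sum>t\<in>T. indicat_real S (t - w))"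
    using assms fT by (intro sum_mono) (auto simp: card_translate_Int intro!: card_mono)
  also have "\<dots> = (\<Sum>t\<in>T. A t)"
    unfolding A_def by (rule sum.swap)
  finally have "real (card R) * k \<le> real (card T) * c + k * sqrt (m * (1 + s / k) - s\<^sup>2)"
    using dev by simp
  also have "\<dots> = (real (card T) * s / m + sqrt (m * (1 + s / k) - s\<^sup>2)) * k"
    by (simp add: c_def field_simps)
  finally show ?thesis using k by (simp add: s_def k_def m_def)
qed

section \<open>Simultaneous Dirichlet approximation with many returns\<close>

text \<open>Pigeonhole: the torus splits into \<open>m ^ d\<close> boxes of side
  \<open>1 / m\<close>, so one box receives more than \<open>H / m ^ d\<close> of the
  \<open>H + 1\<close> multiples of the frequency vector by \<open>0, ..., H\<close>. Differences
  within that box are the returns.\<close>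

lemma dirichlet_many_returns:
  fixes \<alpha> :: "nat \<Rightarrow> real"
  assumes "m > 0"
  obtains W :: "int set" where "W \<subseteq> {- int H..int H}" "H < card W * m ^ d"
    "\<And>w i. w \<in> W \<Longrightarrow> i \<in> {1..d} \<Longrightarrow> dist_int (\<alpha> i * of_int w) \<le> 1 / real m"
proof -
  define f where "f x = (\<lambda>i\<in>{1..d}. \<lfloor>real m * frac (\<alpha> i * of_int x)\<rfloor>)" for x :: int
  define K where "K = {1..d} \<rightarrow>\<^sub>E {0..<int m}"
  have finK: "finite K" and cardK: "card K = m ^ d"
    by (simp_all add: K_def finite_PiE card_PiE)
  have fK: "f x \<in> K" for x
  proof -
    have "real m * frac (\<alpha> i * of_int x) < real m" for i
      using assms frac_lt_1[of "\<alpha> i * of_int x"] by simp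
    then show ?thesis by (auto simp: K_def f_def floor_less_iff)
  qed
  have "\<exists>b\<in>K. H < card {x \<in> {0..int H}. f x = b} * m ^ d"
  proof (rule ccontr)
    assume "\<not> ?thesis"
    then have le: "card {x \<in> {0..int H}. f x = b} * m ^ d \<le> H" if "b \<in> K" for b
      using that by (auto simp: not_less)
    have "Suc H = card (\<Union>b\<in>K. {x \<in> {0..int H}. f x = b})"
      using fK by (subst arg_cong[of _ "{0..int H}" card]) auto
    also have "\<dots> \<le> (\<Sum>b\<in>K. card {x \<in> {0..int H}. f x = b})"
      by (rule card_UN_le[OF finK])
    finally have "Suc H * m ^ d \<le> (\<Sum>b\<in>K. card {x \<in> {0..int H}. f x = b} * m ^ d)"
      unfolding sum_distrib_right[symmetric] by (rule mult_le_mono1)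
    also have "\<dots> \<le> (\<Sum>b\<in>K. H)"
      by (intro sum_mono le)
    also have "\<dots> = H * m ^ d" by (simp add: cardK)
    finally show False using assms by simp
  qed
  then obtain b where b: "H < card {x \<in> {0..int H}. f x = b} * m ^ d" by blast
  let ?X = "{x \<in> {0..int H}. f x = b}"
  from b have "?X \<noteq> {}" by (auto simp del: Collect_empty_eq)
  then obtain y where y: "y \<in> ?X" by blast
  \<comment> \<open>Subtracting one fixed point \<open>y\<close> of the crowded box keeps the
    cardinality and moves the points into \<open>{- H..H}\<close>.\<close>
  show thesis
  proof
    show "(\<lambda>x. x - y) ` ?X \<subseteq> {- int H..int H}" using y by auto
    show "H < card ((\<lambda>x. x - y) ` ?X) * m ^ d" using b by (simp add: card_image)
    fix w i assume "w \<in> (\<lambda>x. x - y) ` ?X" and i: "i \<in> {1..d}"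
    then obtain x where w: "w = x - y" and "f x = f y" using y by auto
    then have eq: "\<lfloor>real m * frac (\<alpha> i * of_int x)\<rfloor> = \<lfloor>real m * frac (\<alpha> i * of_int y)\<rfloor>"
      using i by (metis f_def restrict_apply')
    have "\<bar>real m * frac (\<alpha> i * of_int x) - real m * frac (\<alpha> i * of_int y)\<bar> \<le> 1"
      using eq by linarith
    then have "real m * \<bar>frac (\<alpha> i * of_int x) - frac (\<alpha> i * of_int y)\<bar> \<le> 1"
      by (simp add: abs_mult flip: right_diff_distrib)
    moreover have "dist_int (\<alpha> i * of_int w) \<le> \<bar>frac (\<alpha> i * of_int x) - frac (\<alpha> i * of_int y)\<bar>"
      using dist_int_le[of "\<alpha> i * of_int w" "\<lfloor>\<alpha> i * of_int x\<rfloor> - \<lfloor>\<alpha> i * of_int y\<rfloor>"]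
      by (simp add: w frac_def algebra_simps)
    ultimately have "real m * dist_int (\<alpha> i * of_int w) \<le> 1"
      by (meson mult_left_mono of_nat_0_le_iff order_trans)
    then show "dist_int (\<alpha> i * of_int w) \<le> 1 / real m"
      using assms by (simp add: field_simps)
  qed
qed

section \<open>Transfer of densities for near-extremal Sidon sets\<close>

text \<open>Since \<open>|I| \<le> (1 + 2\<epsilon>) N\<close>,
  \<open>|S| / |W| \<le> 2\<epsilon>\<close> and \<open>|S|\<close> is close to
  \<open>sqrt N\<close>, the deficit under the root is of order \<open>\<epsilon> N\<close>;
  relative to \<open>|S|\<close> its root is of order \<open>sqrt \<epsilon>\<close>. A lower bound
  comes from applying this to the complement.\<close>

lemma dense_sidon_upper_density:
  assumes "sidon S" "S \<subseteq> {1..int N}" "N > 0"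
    and \<epsilon>: "0 < \<epsilon>" "\<epsilon> \<le> 1" "1 \<le> \<epsilon> ^ 3 * sqrt (real N)"
    and S\<epsilon>: "\<bar>real (card S) / sqrt (real N) - 1\<bar> \<le> \<epsilon>" and S100: "sqrt (real N) \<le> 100 * real (card S)"
    and W: "W \<subseteq> {- int H..int H}" "real H \<le> \<epsilon> * real N" "\<epsilon>\<^sup>2 * real N \<le> real (card W)"
    and "R \<subseteq> S" and RW: "\<And>s w. s \<in> R \<Longrightarrow> w \<in> W \<Longrightarrow> s + w \<in> Q"
  shows "real (card R) / real (card S) \<le> real (card (Q \<inter> {1..int N})) / real N + 402 * sqrt \<epsilon>"
proof -
  let ?n = "real N" and ?s = "real (card S)"
  let ?I = "{1 - int H..int N + int H}"
  have n: "?n > 0" "sqrt ?n > 0" using assms by simp_all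
  have s: "?s > 0" using n S100 by linarith
  have finS: "finite S" using assms(2) finite_subset by blast
  have finW: "finite W" using W finite_subset by blast
  have w: "real (card W) > 0"
    using W(3) \<epsilon>(1) n(1) by (intro less_le_trans[OF _ W(3)]) simp
  then have "W \<noteq> {}" by auto
  have cardI: "real (card ?I) = ?n + 2 * real H" by simp
  \<comment> \<open>Outside \<open>[N]\<close>, \<open>I\<close> consists of two blocks of
    \<open>H\<close> integers each.\<close>
  have "card (Q \<inter> ?I) \<le> card ((Q \<inter> {1..int N}) \<union> ({1 - int H..0} \<union> {int N + 1..int N + int H}))"
    by (intro card_mono) auto
  also have "\<dots> \<le> card (Q \<inter> {1..int N}) + (card {1 - int H..0} + card {int N + 1..int N + int H})"
    by (intro order_trans[OF card_Un_le] add_mono card_Un_le order_refl)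
  finally have cardT: "real (card (Q \<inter> ?I)) \<le> real (card (Q \<inter> {1..int N})) + 2 * real H"
    by simp
  have s_le: "?s \<le> (1 + \<epsilon>) * sqrt ?n" and s_ge: "(1 - \<epsilon>) * sqrt ?n \<le> ?s"
    using S\<epsilon> n by (auto simp: abs_le_iff field_simps)
  have "(1 - 2 * \<epsilon>) * ?n \<le> ((1 - \<epsilon>) * sqrt ?n)\<^sup>2"
    using n by (simp add: power_mult_distrib power2_diff mult_right_mono)
  also have "\<dots> \<le> ?s\<^sup>2"
    using s_ge \<epsilon> by (intro power_mono) auto
  finally have s2: "(1 - 2 * \<epsilon>) * ?n \<le> ?s\<^sup>2" .
  \<comment> \<open>The ratio is at most \<open>2 / (\<epsilon>^2 sqrt N)\<close>, and
    \<open>\<epsilon>^3 sqrt N \<ge> 1\<close> turns this into \<open>2\<epsilon>\<close>.\<close>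
  have "?s / real (card W) \<le> 2 * \<epsilon>"
  proof -
    have "?s \<le> 2 * sqrt ?n" using s_le mult_right_mono[of "1 + \<epsilon>" 2 "sqrt ?n"] \<epsilon>(2) n(2) by linarith
    also have "\<dots> \<le> 2 * sqrt ?n * (\<epsilon> ^ 3 * sqrt ?n)"
      using \<epsilon>(3) n(2) by simp
    also have "\<dots> = 2 * \<epsilon> * (\<epsilon>\<^sup>2 * ?n)"
      by (simp add: power2_eq_square power3_eq_cube)
    also have "\<dots> \<le> 2 * \<epsilon> * real (card W)"
      using W(3) \<epsilon>(1) by (intro mult_left_mono) auto
    finally show ?thesis using w by (simp add: field_simps)
  qed
  then have "(?n + 2 * real H) * (1 + ?s / real (card W)) \<le> (?n + 2 * real H) * (1 + 2 * \<epsilon>)"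
    by (intro mult_left_mono) auto
  also have "\<dots> \<le> (?n + 2 * (\<epsilon> * ?n)) * (1 + 2 * \<epsilon>)"
    using W(2) \<epsilon>(1) by (intro mult_right_mono) auto
  also have "\<dots> = ?n + 4 * \<epsilon> * ?n + 4 * \<epsilon> * (\<epsilon> * ?n)"
    by (simp add: algebra_simps)
  also have "\<dots> \<le> ?n + 4 * \<epsilon> * ?n + 4 * \<epsilon> * (1 * ?n)"
    using \<epsilon> n by (intro add_mono mult_left_mono mult_right_mono) auto
  \<comment> \<open>The first term contributes \<open>8\<epsilon>\<close> beyond \<open>N\<close>
    and the square of \<open>|S|\<close> loses \<open>2\<epsilon>\<close>. The total 10 is then
    rounded up to the square 16.\<close>
  finally have "(?n + 2 * real H) * (1 + ?s / real (card W)) - ?s\<^sup>2 \<le> 10 * \<epsilon> * ?n"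
    using s2 by (simp add: algebra_simps)
  also have "\<dots> \<le> (4 * sqrt \<epsilon> * sqrt ?n)\<^sup>2"
    using \<epsilon>(1) n by (simp add: power_mult_distrib)
  finally have "sqrt ((?n + 2 * real H) * (1 + ?s / real (card W)) - ?s\<^sup>2) \<le> 4 * sqrt \<epsilon> * sqrt ?n"
    using \<epsilon>(1) n by (intro real_le_lsqrt) auto
  also have "\<dots> \<le> 4 * sqrt \<epsilon> * (100 * ?s)"
    using S100 \<epsilon>(1) by (intro mult_left_mono) auto
  finally have err: "sqrt ((?n + 2 * real H) * (1 + ?s / real (card W)) - ?s\<^sup>2) \<le> 400 * sqrt \<epsilon> * ?s"
    by simp
  have "real (card R) \<le> real (card (Q \<inter> ?I)) * ?s / real (card ?I)
      + sqrt (real (card ?I) * (1 + ?s / real (card W)) - ?s\<^sup>2)"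
  proof (rule sidon_translates_discrepancy)
    show "s + w \<in> ?I" if "s \<in> S" "w \<in> W" for s w
      using subsetD[OF assms(2) that(1)] subsetD[OF W(1) that(2)] by simp
    then show "s + w \<in> Q \<inter> ?I" if "s \<in> R" "w \<in> W" for s w
      using that RW assms(12) by blast
    show "?I \<noteq> {}" using assms(3) by auto
  qed (use assms finS finW \<open>W \<noteq> {}\<close> in auto)
  then have "real (card R) / ?s \<le> real (card (Q \<inter> ?I)) / (?n + 2 * real H) + 400 * sqrt \<epsilon>"
    using err s unfolding cardI by (simp add: field_simps)
  also have "real (card (Q \<inter> ?I)) / (?n + 2 * real H) \<le> (real (card (Q \<inter> {1..int N})) + 2 * real H) / ?n"
    using cardT n by (intro frac_le) auto
  also have "\<dots> \<le> real (card (Q \<inter> {1..int N})) / ?n + 2 * \<epsilon>"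
    using W(2) n by (simp add: field_simps)
  finally have "real (card R) / ?s \<le> real (card (Q \<inter> {1..int N})) / ?n + 2 * \<epsilon> + 400 * sqrt \<epsilon>"
    by simp
  \<comment> \<open>The boundary term \<open>2\<epsilon>\<close> joins the main error, whence
    \<open>402 = 400 + 2\<close>.\<close>
  moreover have "\<epsilon> \<le> sqrt \<epsilon>"
    using \<epsilon> by (intro real_le_rsqrt) (simp add: power2_eq_square mult_left_le)
  ultimately show ?thesis by linarith
qed

section \<open>Dense Sidon sets in a regular Bohr set\<close>

text \<open>Translates of \<open>S \<inter> B\<close> by \<open>W\<close> stay in a slightly wider
  Bohr set, and those of \<open>S - B\<close> stay out of a slightly narrower one; the density bound
  for each gives one direction. The second condition in \<open>small\<close> places the relative
  change of width in the range of regularity.\<close>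

lemma dense_sidon_regular_bohr:
  assumes "N > 0" "d > 0" "\<rho> > 0" and reg: "regular_bohr N d \<alpha> \<rho>"
    and S: "S \<subseteq> {1..int N}" "sidon S" "sqrt (real N) \<le> 100 * real (card S)"
    and \<epsilon>: "\<epsilon> = \<bar>real (card S) / sqrt (real N) - 1\<bar> + real N powr (- (1 / 6))"
    and \<theta>: "\<theta> = \<epsilon> powr (1 / (14 * real d))"
    and small: "\<rho> < 1 / 2" "200 * real d * \<theta> \<le> \<rho>"
  shows "\<bar>real (card (S \<inter> bohr_set N d \<alpha> \<rho>)) / real (card S)
      - real (card (bohr_set N d \<alpha> \<rho>)) / real N\<bar> \<le> 602 * real d * inverse \<rho> * \<theta>"
proof -
  define B where "B = bohr_set N d \<alpha> \<rho>"
  define \<kappa> where "\<kappa> = 2 * \<theta> / \<rho>"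
  have N6: "real N powr (- (1 / 6)) > 0" and \<epsilon>N: "real N powr (- (1 / 6)) \<le> \<epsilon>"
    using assms by (auto simp: \<epsilon>)
  then have \<epsilon>0: "\<epsilon> > 0" by linarith
  have \<theta>0: "\<theta> > 0" using \<epsilon>0 by (simp add: \<theta>)
  have d1: "real d \<ge> 1" using assms(2) by simp
  have \<theta>d: "200 * \<theta> \<le> 200 * real d * \<theta>" using d1 \<theta>0 by simp
  then have \<theta>small: "\<theta> \<le> 1 / 400" using small by linarith
  have \<epsilon>1: "\<epsilon> \<le> 1"
  proof (rule ccontr)
    assume "\<not> \<epsilon> \<le> 1"
    then have "\<theta> \<ge> 1" using assms(2) by (auto simp: \<theta> intro!: ge_one_powr_ge_zero)
    with \<theta>small show False by simp
  qed
  have sqrt\<theta>: "sqrt \<epsilon> \<le> \<theta>"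
    unfolding \<theta> using \<epsilon>0 \<epsilon>1 d1 by (subst powr_half_sqrt[symmetric]) (auto intro!: powr_mono')
  \<comment> \<open>The \<open>1 / d\<close> in the exponent pays for the \<open>m ^ d\<close>
    boxes: with \<open>m \<le> 1 / \<theta>\<close> they cost a factor \<open>\<theta> ^ d\<close>,
    which must not fall below \<open>\<epsilon>\<close>.\<close>
  have \<theta>_pow: "\<epsilon> \<le> \<theta> ^ d"
  proof -
    have "\<theta> ^ d = \<epsilon> powr (1 / 14)"
      using \<theta>0 assms(2) by (simp add: \<theta> powr_powr flip: powr_realpow)
    moreover have "\<epsilon> powr 1 \<le> \<epsilon> powr (1 / 14)"
      using \<epsilon>0 \<epsilon>1 by (intro powr_mono') auto
    ultimately show ?thesis using \<epsilon>0 by simp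
  qed
  \<comment> \<open>The exponent \<open>-1/6\<close> is chosen so that its cube cancels
    \<open>sqrt N\<close>.\<close>
  have "1 = (real N powr (- (1 / 6))) ^ 3 * sqrt (real N)"
    using assms(1) by (simp add: powr_half_sqrt[symmetric] powr_powr powr_add[symmetric]
        flip: powr_realpow)
  also have "\<dots> \<le> \<epsilon> ^ 3 * sqrt (real N)"
    using \<epsilon>N N6 by (intro mult_right_mono power_mono) auto
  finally have \<epsilon>3: "1 \<le> \<epsilon> ^ 3 * sqrt (real N)" .
  have S\<epsilon>: "\<bar>real (card S) / sqrt (real N) - 1\<bar> \<le> \<epsilon>"
    using N6 by (simp add: \<epsilon>)
  define H where "H = nat \<lfloor>\<epsilon> * real N\<rfloor>"
  have H: "real H \<le> \<epsilon> * real N" "\<epsilon> * real N \<le> real (Suc H)"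
    using \<epsilon>0 unfolding H_def by (simp_all, linarith+)
  \<comment> \<open>Rounding up makes \<open>1 / m \<le> 2\<theta> = \<kappa> \<rho>\<close>; since
    \<open>1 / (2\<theta>)\<close> exceeds 1, rounding at most doubles it, so also
    \<open>m \<theta> \<le> 1\<close>.\<close>
  define m where "m = nat \<lceil>1 / (2 * \<theta>)\<rceil>"
  have "1 / (2 * \<theta>) \<ge> 200" using \<theta>0 \<theta>small by (simp add: field_simps)
  moreover from this have m: "1 / (2 * \<theta>) \<le> real m" "real m \<le> 1 / (2 * \<theta>) + 1"
    unfolding m_def by linarith+
  ultimately have m_pos: "real m > 0" and "real m \<le> 2 * (1 / (2 * \<theta>))"
    by linarith+
  then have m_le: "real m \<le> 1 / \<theta>" by simp
  have m_inv: "1 / real m \<le> \<kappa> * \<rho>"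
    using m(1) m_pos \<theta>0 assms(3) by (simp add: \<kappa>_def field_simps)
  obtain W where W: "W \<subseteq> {- int H..int H}" "H < card W * m ^ d"
    "\<And>w i. w \<in> W \<Longrightarrow> i \<in> {1..d} \<Longrightarrow> dist_int (\<alpha> i * of_int w) \<le> 1 / real m"
    using dirichlet_many_returns[of m H d \<alpha>] m_pos by (metis of_nat_0_less_iff)
  have W\<kappa>: "dist_int (\<alpha> i * of_int w) \<le> \<kappa> * \<rho>" if "w \<in> W" "i \<in> {1..d}" for w i
    using W(3)[OF that] m_inv by linarith
  have cardW: "\<epsilon>\<^sup>2 * real N \<le> real (card W)"
  proof -
    \<comment> \<open>The strict inequality supplies \<open>H + 1\<close>, which makes up for the
      floor in \<open>H\<close>.\<close>
    have "real (Suc H) \<le> real (card W * m ^ d)"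
      using W(2) by (intro of_nat_mono) simp
    then have le: "\<epsilon> * real N \<le> real (card W * m ^ d)"
      using H(2) by linarith
    have "\<epsilon> * (\<epsilon> * real N) \<le> \<theta> ^ d * (\<epsilon> * real N)"
      using \<theta>_pow \<epsilon>0 by (intro mult_right_mono) auto
    also have "\<dots> \<le> \<theta> ^ d * real (card W * m ^ d)"
      using \<theta>0 le by (intro mult_left_mono) auto
    also have "\<dots> = real (card W) * (\<theta> * real m) ^ d"
      by (simp add: power_mult_distrib)
    also have "\<dots> \<le> real (card W) * 1"
      using m_le \<theta>0 m_pos by (intro mult_left_mono power_le_one) (auto simp: field_simps)
    finally show ?thesis by (simp add: power2_eq_square mult_ac)
  qed
  have density: "real (card R) / real (card S) \<le> real (card (Q \<inter> {1..int N})) / real N + 402 * \<theta>"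
    if "R \<subseteq> S" "\<And>s w. s \<in> R \<Longrightarrow> w \<in> W \<Longrightarrow> s + w \<in> Q" for R Q
    using dense_sidon_upper_density[OF S(2,1) assms(1) \<epsilon>0 \<epsilon>1 \<epsilon>3 S\<epsilon> S(3) W(1) H(1) cardW that] sqrt\<theta>
    by simp
  have finS: "finite S" using S(1) finite_subset by blast
  have s: "real (card S) > 0"
    using S(3) assms(1) by (cases "card S = 0") auto
  have BN: "bohr_set N d \<alpha> r \<subseteq> {1..int N}" for r
    by (auto simp: bohr_set_def initial_segment_def)
  have \<kappa>0: "\<kappa> > 0" using \<theta>0 assms(3) by (simp add: \<kappa>_def)
  have \<kappa>1: "\<kappa> \<le> 1 / (100 * real d)"
    using small(2) assms(2,3) by (simp add: \<kappa>_def field_simps)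
  have cardB: "real (card B) > 0"
  proof -
    \<comment> \<open>As \<open>0 / 0 = 0\<close>, an empty \<open>B\<close> would give
      \<open>1 \<le> 0\<close>.\<close>
    have "\<bar>real (card B) / real (card B) - 1\<bar> \<le> 0"
      using reg[unfolded regular_bohr_def, rule_format, of 0] by (simp add: B_def split: if_splits)
    then show ?thesis by (cases "card B = 0") (simp_all split: if_splits)
  qed
  have "finite {1..int N}" by simp
  then have B_le_N: "real (card B) \<le> real N"
    using card_mono[OF _ BN[of \<rho>]] by (simp add: B_def)
  have regular: "\<bar>real (card (bohr_set N d \<alpha> ((1 + k) * \<rho>))) / real N - real (card B) / real N\<bar> \<le> 100 * real d * \<kappa>"
    if "\<bar>k\<bar> = \<kappa>" for k
  proof -
    let ?b = "real (card (bohr_set N d \<alpha> ((1 + k) * \<rho>)))"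
    have "?b / real N - real (card B) / real N = (?b / real (card B) - 1) * (real (card B) / real N)"
      using cardB by (simp add: left_diff_distrib diff_divide_distrib)
    then have "\<bar>?b / real N - real (card B) / real N\<bar>
        = \<bar>?b / real (card B) - 1\<bar> * (real (card B) / real N)"
      by (simp add: abs_mult)
    also have "\<dots> \<le> 100 * real d * \<kappa> * 1"
      using reg[unfolded regular_bohr_def, rule_format, of k] that \<kappa>0 \<kappa>1 B_le_N assms(1)
      by (intro mult_mono) (auto simp: B_def)
    finally show ?thesis by simp
  qed
  have upper: "real (card (S \<inter> B)) / real (card S) \<le> real (card B) / real N + 100 * real d * \<kappa> + 402 * \<theta>"
  proof -
    \<comment> \<open>\<open>Q\<close> is not cut down to \<open>[N]\<close>, because
      \<open>s + w\<close> may leave it.\<close>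
    define Q where "Q = {x::int. \<forall>i\<in>{1..d}. dist_int (\<alpha> i * of_int x) \<le> (1 + \<kappa>) * \<rho>}"
    have "s + w \<in> Q" if "s \<in> S \<inter> B" "w \<in> W" for s w
    proof -
      have "dist_int (\<alpha> i * of_int (s + w)) \<le> (1 + \<kappa>) * \<rho>" if i: "i \<in> {1..d}" for i
      proof -
        have "dist_int (\<alpha> i * of_int s) \<le> \<rho>"
          using \<open>s \<in> S \<inter> B\<close> i mem_bohr_set_iff[OF assms(2), of s N \<alpha> \<rho>] by (simp add: B_def)
        with dist_int_add_le[of "\<alpha> i * of_int s" "\<alpha> i * of_int w"] W\<kappa>[OF \<open>w \<in> W\<close> i]
        show ?thesis by (simp add: distrib_left distrib_right)
      qed
      then show ?thesis by (simp add: Q_def)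
    qed
    from density[OF Int_lower1 this] have "real (card (S \<inter> B)) / real (card S) \<le> real (card (Q \<inter> {1..int N})) / real N + 402 * \<theta>" .
    also have "Q \<inter> {1..int N} = bohr_set N d \<alpha> ((1 + \<kappa>) * \<rho>)"
      using mem_bohr_set_iff[OF assms(2)] by (auto simp: Q_def)
    finally show ?thesis using regular[of \<kappa>] \<kappa>0 by linarith
  qed
  have lower: "real (card B) / real N \<le> real (card (S \<inter> B)) / real (card S) + 100 * real d * \<kappa> + 402 * \<theta>"
  proof -
    \<comment> \<open>\<open>Q\<close> is the complement of the narrower Bohr set over all integers:
      a coordinate where \<open>s\<close> exceeds \<open>\<rho>\<close> drops by at most
      \<open>\<kappa> \<rho>\<close> under translation.\<close>
    define Q where "Q = {x::int. \<exists>i\<in>{1..d}. dist_int (\<alpha> i * of_int x) > (1 + - \<kappa>) * \<rho>}"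
    have "s + w \<in> Q" if "s \<in> S - B" "w \<in> W" for s w
    proof -
      have "s \<in> {1..int N}" "s \<notin> bohr_set N d \<alpha> \<rho>"
        using that(1) S(1) by (auto simp: B_def)
      then obtain i where i: "i \<in> {1..d}" "dist_int (\<alpha> i * of_int s) > \<rho>"
        unfolding mem_bohr_set_iff[OF assms(2)] not_le[symmetric] by blast
      have "dist_int (\<alpha> i * of_int s) \<le> dist_int (\<alpha> i * of_int (s + w)) + dist_int (- (\<alpha> i * of_int w))"
        using dist_int_add_le[of "\<alpha> i * of_int (s + w)" "- (\<alpha> i * of_int w)"]
        by (simp add: algebra_simps)
      then have "dist_int (\<alpha> i * of_int (s + w)) > (1 + - \<kappa>) * \<rho>"
        using i dist_int_uminus_le[of "\<alpha> i * of_int w"] W\<kappa>[OF that(2) i(1)]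
        by (simp add: left_diff_distrib)
      then show ?thesis using i(1) unfolding Q_def by blast
    qed
    from density[OF Diff_subset this] have le: "real (card (S - B)) / real (card S) \<le> real (card (Q \<inter> {1..int N})) / real N + 402 * \<theta>" .
    have Q: "Q \<inter> {1..int N} = {1..int N} - bohr_set N d \<alpha> ((1 + - \<kappa>) * \<rho>)"
      unfolding set_eq_iff Diff_iff Int_iff mem_bohr_set_iff[OF assms(2)] Q_def mem_Collect_eq
        not_le[symmetric] by blast
    have "real (card (Q \<inter> {1..int N})) = real N - real (card (bohr_set N d \<alpha> ((1 + - \<kappa>) * \<rho>)))"
      unfolding Q using card_Diff_subset[OF _ BN] card_mono[OF \<open>finite {1..int N}\<close> BN]
      by (simp add: finite_subset[OF BN] of_nat_diff)
    moreover have "real (card (S - B)) = real (card S) - real (card (S \<inter> B))"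
      using finS by (simp add: card_Diff_subset_Int of_nat_diff card_mono)
    \<comment> \<open>Complementing both densities turns the upper bound for \<open>S - B\<close>
      into a lower bound for \<open>S \<inter> B\<close>.\<close>
    ultimately have "1 - real (card (S \<inter> B)) / real (card S)
        \<le> 1 - real (card (bohr_set N d \<alpha> ((1 + - \<kappa>) * \<rho>))) / real N + 402 * \<theta>"
      using le s assms(1) by (simp only: diff_divide_distrib) simp
    then show ?thesis using regular[of "- \<kappa>"] \<kappa>0 by linarith
  qed
  have "100 * real d * \<kappa> = 200 * (real d * inverse \<rho> * \<theta>)"
    by (simp add: \<kappa>_def divide_inverse)
  \<comment> \<open>As \<open>d / \<rho> \<ge> 1\<close>, the term \<open>402 \<theta>\<close> is
    absorbed, and \<open>602 = 200 + 402\<close>.\<close>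
  moreover have "1 * \<theta> \<le> real d * inverse \<rho> * \<theta>"
  proof (rule mult_right_mono)
    have "1 * 1 \<le> real d * inverse \<rho>"
      using d1 small(1) assms(3) by (intro mult_mono) (auto simp: field_simps)
    then show "1 \<le> real d * inverse \<rho>" by simp
  qed (use \<theta>0 in simp)
  ultimately show ?thesis using upper lower unfolding B_def[symmetric] by linarith
qed

section \<open>Trivial ranges of the parameters and the conclusion\<close>

theorem corollary1p11:
  "\<exists>C::real. C > 0 \<and>
    (\<forall>(N::nat) (d::nat) (\<alpha>::nat \<Rightarrow> real) (\<rho>::real).
      N > 0 \<longrightarrow> d > 0 \<longrightarrow> \<rho> > 0 \<longrightarrow> regular_bohr N d \<alpha> \<rho> \<longrightarrow>
      (\<forall>S. S \<subseteq> initial_segment N \<longrightarrow> sidon S \<longrightarrow>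
        real (card S) \<ge> 1 / 100 * real N powr (1 / 2) \<longrightarrow>
        \<bar>average S (indicat_real (bohr_set N d \<alpha> \<rho>)) -
          average (initial_segment N) (indicat_real (bohr_set N d \<alpha> \<rho>))\<bar>
          \<le> C * real d * inverse \<rho> *
             (\<bar>real (card S) / real N powr (1 / 2) - 1\<bar> + real N powr (- (1 / 6)))
               powr (1 / (14 * real d))))"
proof (intro exI[of _ 602] conjI allI impI)
  fix N d :: nat and \<alpha> :: "nat \<Rightarrow> real" and \<rho> :: real and S :: "int set"
  assume N: "N > 0" and d: "d > 0" and \<rho>: "\<rho> > 0" and reg: "regular_bohr N d \<alpha> \<rho>"
    and S: "S \<subseteq> initial_segment N" "sidon S" "real (card S) \<ge> 1 / 100 * real N powr (1 / 2)"
  let ?B = "bohr_set N d \<alpha> \<rho>"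
  define \<epsilon> where "\<epsilon> = \<bar>real (card S) / real N powr (1 / 2) - 1\<bar> + real N powr (- (1 / 6))"
  define \<theta> where "\<theta> = \<epsilon> powr (1 / (14 * real d))"
  have finS: "finite S" using S(1) by (auto simp: initial_segment_def intro: finite_subset)
  have S_ne: "card S > 0" using S(3) N by (cases "card S = 0") auto
  have BN: "initial_segment N \<inter> ?B = ?B" by (auto simp: bohr_set_def)
  have avg: "average S (indicat_real ?B) = real (card (S \<inter> ?B)) / real (card S)"
    "average (initial_segment N) (indicat_real ?B) = real (card ?B) / real N"
    using finS by (simp_all add: average_indicat_real BN) (simp_all add: average_indicat_real initial_segment_def BN[unfolded initial_segment_def])
  have "\<bar>real (card (S \<inter> ?B)) / real (card S) - real (card ?B) / real N\<bar>
      \<le> 602 * real d * inverse \<rho> * \<theta>"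
  proof (cases "\<rho> < 1 / 2")
    \<comment> \<open>No distance to the integers exceeds \<open>1 / 2\<close>, so \<open>B\<close>
      is all of \<open>[N]\<close> and both averages are 1.\<close>
    case False
    then have "?B = {1..int N}"
      using mem_bohr_set_iff[OF d] by (auto simp: not_less intro!: order_trans[OF dist_int_le_half])
    moreover from this S(1) have "S \<inter> ?B = S" by (auto simp: initial_segment_def)
    ultimately have "real (card (S \<inter> ?B)) / real (card S) - real (card ?B) / real N = 0"
      using N S_ne by simp
    then show ?thesis using \<rho> by (simp add: \<theta>_def)
  next
    case \<rho>_half: True
    show ?thesis
    proof (cases "200 * real d * \<theta> \<le> \<rho>")
      case True
      show ?thesis
        by (rule dense_sidon_regular_bohr[OF N d \<rho> reg _ S(2) _ _ \<theta>_def \<rho>_half True])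
          (use S in \<open>auto simp: \<epsilon>_def initial_segment_def powr_half_sqrt\<close>)
    next
      \<comment> \<open>Here the right-hand side is larger than \<open>602 / 200\<close>, while two
        numbers in \<open>[0, 1]\<close> differ by at most 1.\<close>
      case False
      have "0 \<le> real (card (S \<inter> ?B)) / real (card S)" "real (card (S \<inter> ?B)) / real (card S) \<le> 1"
        using finS by (auto simp: divide_le_eq_1 card_mono)
      moreover have "0 \<le> real (card ?B) / real N" "real (card ?B) / real N \<le> 1"
        using card_mono[of "initial_segment N" ?B] BN by (auto simp: divide_le_eq_1 initial_segment_def)
      ultimately have "\<bar>real (card (S \<inter> ?B)) / real (card S) - real (card ?B) / real N\<bar> \<le> 1"
        by linarith
      also have "1 \<le> 602 * real d * inverse \<rho> * \<theta>"
        using False \<rho> by (simp add: field_simps)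
      finally show ?thesis .
    qed
  qed
  then show "\<bar>average S (indicat_real ?B) - average (initial_segment N) (indicat_real ?B)\<bar>
      \<le> 602 * real d * inverse \<rho> *
        (\<bar>real (card S) / real N powr (1 / 2) - 1\<bar> + real N powr (- (1 / 6))) powr (1 / (14 * real d))"
    unfolding avg \<theta>_def \<epsilon>_def .
qed simp

end
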